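(* Let $G=(L,R,E)$ be a finite simple bipartite graph with $L=\{u_1,\dots,u_l\}$, $R=\{v_1,\dots,v_r\}$, all edges directed from $L$ to $R$, and let $(c_1,\dots,c_l)$ be non-negative integers with $\deg_G^+(u_i)\ge c_i$ for all $i$. Suppose $\sum_{i=1}^l c_i\ge r=|R|$. Let $\mathcal N$ be the flow network for $\text{MIN-DISCREPANCY}(G,\{c_i\}_{i=1}^l,\{1\}_{j=1}^r)$ described in the context (all targets $a_j=1$). Then any integral minimum cost flow in $\mathcal N$ maximizes aggregate diversity: the subgraph $H$ of $G$ consisting of the edges $(u_i,v_j)$ that carry flow has the maximum aggregate diversity among all subgraphs $H'$ of $G$ with $\deg^+_{H'}(u_i)=c_i$ for all $u_i\in L$.
   Context: The aggregate diversity of a subgraph $H$ of $G$ is the number of items recommended at least once, i.e. $|\{v_j\in R:\deg_H^-(v_j)\ge 1\}|$. $\text{MIN-DISCREPANCY}(G,\{c_i\},\{a_j\})$ is the problem of minimizing $\sum_{v_j\in R}|\deg_H^-(v_j)-a_j|$ over subgraphs $H$ of $G$ with $\deg_H^+(u_i)=c_i$ for all $i$; here $a_j=1$ for all $j$. Flow network $\mathcal N$: its nodes are a copy of each node of $G$ together with two special nodes $t_1,t_2$. Each $u_i\in L$ has supply $c_i$, the node $t_2$ has demand $\sum_{i=1}^l c_i$, and all other nodes have zero supply and demand. The arcs are: - for each edge $(u_i,v_j)\in E$, an arc $(u_i,v_j)$ with capacity $1$ and cost $0$; - for each $v_j\in R$, an arc $(v_j,t_1)$ with capacity $a_j=1$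 and cost $0$; - for each $v_j\in R$, an arc $(v_j,t_2)$ with infinite capacity and cost $2$ per unit of flow; - an arc $(t_1,t_2)$ with infinite capacity and cost $0$. *)

theory Defs
  imports Complex_Main "HOL-Library.Extended_Real" "Graph_Theory.Graph_Theory"
begin

text \<open>
  Directed bipartite graphs are \<open>pair_pre_digraph\<close>s: arcs are pairs of vertices, so there are
  no parallel arcs, and the conditions below also exclude loops.
\<close>

locale directed_bipartite_graph = pair_fin_digraph G
  for G :: "'a pair_pre_digraph" +
  fixes L R :: "'a set"
  assumes verts_bipartition: "pverts G = L \<union> R"
    and sides_disjoint: "L \<inter> R = {}"
    and arcs_left_to_right: "parcs G \<subseteq> L \<times> R"

definition aggregate_diversity :: "'a set \<Rightarrow> 'a pair_pre_digraph \<Rightarrow> nat" where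
  "aggregate_diversity R H = card {v \<in> R. in_degree H v \<ge> 1}"

definition recommendation_subgraph ::
    "'a pair_pre_digraph \<Rightarrow> 'a set \<Rightarrow> ('a \<Rightarrow> nat) \<Rightarrow> 'a pair_pre_digraph \<Rightarrow> bool" where
  "recommendation_subgraph G L c H \<longleftrightarrow> subgraph H G \<and> (\<forall>u\<in>L. out_degree H u = c u)"

text \<open>Demands are negative supplies.\<close>

record 'n flow_network =
  net_graph :: "'n pair_pre_digraph"
  node_supply :: "'n \<Rightarrow> real"
  capacity :: "'n \<times> 'n \<Rightarrow> ereal"
  arc_cost :: "'n \<times> 'n \<Rightarrow> real"

text \<open>Only the values of a flow on the arcs of the network matter.\<close>

definition feasible_flow :: "'n flow_network \<Rightarrow> ('n \<times> 'n \<Rightarrow> real) \<Rightarrow> bool" where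
  "feasible_flow N f \<longleftrightarrow>
     (\<forall>e \<in> parcs (net_graph N). 0 \<le> f e \<and> ereal (f e) \<le> capacity N e) \<and>
     (\<forall>x \<in> pverts (net_graph N).
        (\<Sum>e \<in> out_arcs (net_graph N) x. f e) - (\<Sum>e \<in> in_arcs (net_graph N) x. f e) = node_supply N x)"

definition flow_cost :: "'n flow_network \<Rightarrow> ('n \<times> 'n \<Rightarrow> real) \<Rightarrow> real" where
  "flow_cost N f = (\<Sum>e \<in> parcs (net_graph N). arc_cost N e * f e)"

definition min_cost_flow :: "'n flow_network \<Rightarrow> ('n \<times> 'n \<Rightarrow> real) \<Rightarrow> bool" where
  "min_cost_flow N f \<longleftrightarrow>
     feasible_flow N f \<and> (\<forall>g. feasible_flow N g \<longrightarrow> flow_cost N f \<le> flow_cost N g)"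

definition integral_flow :: "'n flow_network \<Rightarrow> ('n \<times> 'n \<Rightarrow> real) \<Rightarrow> bool" where
  "integral_flow N f \<longleftrightarrow> (\<forall>e \<in> parcs (net_graph N). f e \<in> \<int>)"

datatype 'a net_node = Copy 'a | T1 | T2

fun discrepancy_supply :: "'a set \<Rightarrow> ('a \<Rightarrow> nat) \<Rightarrow> 'a net_node \<Rightarrow> real" where
  "discrepancy_supply L c (Copy x) = (if x \<in> L then real (c x) else 0)"
| "discrepancy_supply L c T1 = 0"
| "discrepancy_supply L c T2 = - real (\<Sum>u\<in>L. c u)"

text \<open>
  In the next two functions the catch-all equation is only relevant for the remaining arcs of the
  network; pairs that are not arcs play no role.
\<close>

fun discrepancy_capacity :: "('a \<Rightarrow> nat) \<Rightarrow> 'a net_node \<times> 'a net_node \<Rightarrow> ereal" where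
  "discrepancy_capacity a (Copy u, Copy v) = 1"
| "discrepancy_capacity a (Copy v, T1) = ereal (real (a v))"
| "discrepancy_capacity a _ = \<infinity>"

fun discrepancy_cost :: "'a net_node \<times> 'a net_node \<Rightarrow> real" where
  "discrepancy_cost (Copy v, T2) = 2"
| "discrepancy_cost _ = 0"

definition min_discrepancy_network ::
    "'a pair_pre_digraph \<Rightarrow> 'a set \<Rightarrow> 'a set \<Rightarrow> ('a \<Rightarrow> nat) \<Rightarrow> ('a \<Rightarrow> nat) \<Rightarrow> 'a net_node flow_network" where
  "min_discrepancy_network G L R c a =
     \<lparr> net_graph =
         \<lparr> pverts = Copy ` pverts G \<union> {T1, T2},
           parcs = {(Copy u, Copy v) | u v. (u, v) \<in> parcs G}
                 \<union> {(Copy v, T1) | v. v \<in> R}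
                 \<union> {(Copy v, T2) | v. v \<in> R}
                 \<union> {(T1, T2)} \<rparr>,
       node_supply = discrepancy_supply L c,
       capacity = discrepancy_capacity a,
       arc_cost = discrepancy_cost \<rparr>"

definition flow_subgraph ::
    "'a pair_pre_digraph \<Rightarrow> ('a net_node \<times> 'a net_node \<Rightarrow> real) \<Rightarrow> 'a pair_pre_digraph" where
  "flow_subgraph G f =
     \<lparr> pverts = pverts G, parcs = {(u, v) \<in> parcs G. f (Copy u, Copy v) > 0} \<rparr>"

end

theory Submission
  imports Defs
begin

text \<open>
  By conservation, the arcs from a node \<open>v \<in> R\<close> to \<open>T1\<close> and \<open>T2\<close> carry the in-degree of \<open>v\<close> in total,
  of which at most one unit travels for free through \<open>T1\<close>. Hence an integral flow costs at least twice
  the difference of \<open>\<Sum>u\<in>L. c u\<close> and the diversity of its subgraph, while every recommendation subgraph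
  supports a flow that attains this bound.
\<close>

text \<open>Sums over arcs of \<open>G\<close> inside the network are reindexed along this injective
  map, which keeps each arc a single term.\<close>

abbreviation copy_arc :: "'a \<times> 'a \<Rightarrow> 'a net_node \<times> 'a net_node" where
  "copy_arc \<equiv> map_prod Copy Copy"

lemma inj_copy_arc: "inj_on copy_arc A"
  by (auto simp: inj_on_def)

context directed_bipartite_graph
begin

section \<open>Arcs, feasibility and cost in the network\<close>

lemma finite_sides [simp]: "finite L" "finite R"
  using pair_finite_verts verts_bipartition by auto

lemma parcs_network:
  "parcs (net_graph (min_discrepancy_network G L R c a)) =
     copy_arc ` parcs G \<union> (\<lambda>v. (Copy v, T1)) ` R \<union> (\<lambda>v. (Copy v, T2)) ` R \<union> {(T1, T2)}"
  by (force simp: min_discrepancy_network_def)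

lemma pverts_network:
  "pverts (net_graph (min_discrepancy_network G L R c a)) = Copy ` L \<union> Copy ` R \<union> {T1, T2}"
  by (auto simp: min_discrepancy_network_def verts_bipartition)

text \<open>Since the arcs of \<open>G\<close> run from \<open>L\<close> to \<open>R\<close> and the
  sides are disjoint, a left node has no arc to \<open>T1\<close> or \<open>T2\<close>, and a right
  node has only those two.\<close>

lemma out_arcs_network:
  fixes c a :: "'a \<Rightarrow> nat"
  defines "N \<equiv> net_graph (min_discrepancy_network G L R c a)"
  shows "u \<in> L \<Longrightarrow> out_arcs N (Copy u) = copy_arc ` out_arcs G u"
    and "v \<in> R \<Longrightarrow> out_arcs N (Copy v) = {(Copy v, T1), (Copy v, T2)}"
    and "out_arcs N T1 = {(T1, T2)}"
    and "out_arcs N T2 = {}"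
  unfolding out_arcs_def N_def with_proj_simps parcs_network
  using arcs_left_to_right sides_disjoint by force+

lemma in_arcs_network:
  fixes c a :: "'a \<Rightarrow> nat"
  defines "N \<equiv> net_graph (min_discrepancy_network G L R c a)"
  shows "u \<in> L \<Longrightarrow> in_arcs N (Copy u) = {}"
    and "v \<in> R \<Longrightarrow> in_arcs N (Copy v) = copy_arc ` in_arcs G v"
    and "in_arcs N T1 = (\<lambda>v. (Copy v, T1)) ` R"
    and "in_arcs N T2 = insert (T1, T2) ((\<lambda>v. (Copy v, T2)) ` R)"
  unfolding in_arcs_def N_def with_proj_simps parcs_network
  using arcs_left_to_right sides_disjoint by force+

text \<open>Infinite capacities leave only sign conditions. The last four equations are conservation
  at \<open>L\<close>, \<open>R\<close>, \<open>T1\<close> and \<open>T2\<close>, the one at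
  \<open>T2\<close> with its sign reversed.\<close>

lemma feasible_flow_network_iff:
  "feasible_flow (min_discrepancy_network G L R c a) f \<longleftrightarrow>
     (\<forall>e\<in>parcs G. 0 \<le> f (copy_arc e) \<and> f (copy_arc e) \<le> 1) \<and>
     (\<forall>v\<in>R. 0 \<le> f (Copy v, T1) \<and> f (Copy v, T1) \<le> real (a v) \<and> 0 \<le> f (Copy v, T2)) \<and>
     0 \<le> f (T1, T2) \<and>
     (\<forall>u\<in>L. (\<Sum>e\<in>out_arcs G u. f (copy_arc e)) = real (c u)) \<and>
     (\<forall>v\<in>R. f (Copy v, T1) + f (Copy v, T2) = (\<Sum>e\<in>in_arcs G v. f (copy_arc e))) \<and>
     f (T1, T2) = (\<Sum>v\<in>R. f (Copy v, T1)) \<and>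
     f (T1, T2) + (\<Sum>v\<in>R. f (Copy v, T2)) = (\<Sum>u\<in>L. real (c u))"
proof -
  let ?N = "min_discrepancy_network G L R c a"
  have bounds: "(\<forall>e\<in>parcs (net_graph ?N). 0 \<le> f e \<and> ereal (f e) \<le> capacity ?N e) \<longleftrightarrow>
     (\<forall>e\<in>parcs G. 0 \<le> f (copy_arc e) \<and> f (copy_arc e) \<le> 1) \<and>
     (\<forall>v\<in>R. 0 \<le> f (Copy v, T1) \<and> f (Copy v, T1) \<le> real (a v) \<and> 0 \<le> f (Copy v, T2)) \<and>
     0 \<le> f (T1, T2)"
    unfolding parcs_network by (auto simp: min_discrepancy_network_def ball_Un one_ereal_def)
  have "node_supply ?N = discrepancy_supply L c"
    by (simp add: min_discrepancy_network_def)
  \<comment> \<open>Disjointness of the sides gives right nodes supply 0 in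
    \<open>discrepancy_supply\<close>.\<close>
  moreover have "v \<notin> L" if "v \<in> R" for v
    using that sides_disjoint by auto
  ultimately have conservation: "(\<forall>x\<in>pverts (net_graph ?N).
      (\<Sum>e\<in>out_arcs (net_graph ?N) x. f e) - (\<Sum>e\<in>in_arcs (net_graph ?N) x. f e)
        = node_supply ?N x) \<longleftrightarrow>
     (\<forall>u\<in>L. (\<Sum>e\<in>out_arcs G u. f (copy_arc e)) = real (c u)) \<and>
     (\<forall>v\<in>R. f (Copy v, T1) + f (Copy v, T2) = (\<Sum>e\<in>in_arcs G v. f (copy_arc e))) \<and>
     f (T1, T2) = (\<Sum>v\<in>R. f (Copy v, T1)) \<and>
     f (T1, T2) + (\<Sum>v\<in>R. f (Copy v, T2)) = (\<Sum>u\<in>L. real (c u))"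
    unfolding pverts_network
    by (simp add: ball_Un out_arcs_network in_arcs_network sum.reindex[OF inj_copy_arc]
        sum.reindex inj_on_def image_iff) auto
  show ?thesis
    unfolding feasible_flow_def bounds conservation by blast
qed

lemma flow_cost_network:
  "flow_cost (min_discrepancy_network G L R c a) f = 2 * (\<Sum>v\<in>R. f (Copy v, T2))"
proof -
  let ?N = "min_discrepancy_network G L R c a"
  have "flow_cost ?N f = (\<Sum>e\<in>(\<lambda>v. (Copy v, T2)) ` R. discrepancy_cost e * f e)"
    unfolding flow_cost_def parcs_network
    \<comment> \<open>Only the arcs from \<open>Copy v\<close> to \<open>T2\<close> have nonzero
      cost; all others drop out of the sum.\<close>
    by (rule sum.mono_neutral_cong_right)
       (auto simp: min_discrepancy_network_def pair_finite_arcs)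
  then show ?thesis
    by (simp add: sum.reindex inj_on_def sum_distrib_left)
qed

section \<open>Degree sums and diversity\<close>

lemma sum_in_degree:
  assumes "recommendation_subgraph G L c H"
  shows "(\<Sum>v\<in>R. in_degree H v) = (\<Sum>u\<in>L. c u)"
proof -
  from assms have sub: "parcs H \<subseteq> parcs G" and deg: "\<And>u. u \<in> L \<Longrightarrow> out_degree H u = c u"
    by (auto simp: recommendation_subgraph_def subgraph_def)
  have fin: "finite (parcs H)"
    using sub pair_finite_arcs finite_subset by blast
  have sides: "fst ` parcs H \<subseteq> L" "snd ` parcs H \<subseteq> R"
    using sub arcs_left_to_right by auto
  \<comment> \<open>Double counting: in-arcs are the fibres of \<open>snd\<close> on
    \<open>parcs H\<close>, out-arcs those of \<open>fst\<close>, so summing the constant 1 over the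
    fibres counts each arc once.\<close>
  have "(\<Sum>v\<in>R. in_degree H v) = card (parcs H)"
    using sum.group[OF fin finite_sides(2) sides(2), of "\<lambda>_. 1::nat"]
    by (simp add: in_degree_def in_arcs_def)
  also have "\<dots> = (\<Sum>u\<in>L. out_degree H u)"
    using sum.group[OF fin finite_sides(1) sides(1), of "\<lambda>_. 1::nat"]
    by (simp add: out_degree_def out_arcs_def)
  finally show ?thesis
    by (simp add: deg)
qed

text \<open>Both the flow built from a subgraph and a given integral flow are 0 or 1 on the copied
  arcs; this turns their conservation sums into degrees.\<close>

lemma sum_parcs_indicator:
  fixes H :: "'a pair_pre_digraph"
  assumes "parcs H \<subseteq> parcs G"
  shows "(\<Sum>e\<in>out_arcs G x. if e \<in> parcs H then 1 else 0) = real (out_degree H x)"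
    and "(\<Sum>e\<in>in_arcs G x. if e \<in> parcs H then 1 else 0) = real (in_degree H x)"
proof -
  have "out_arcs G x \<inter> parcs H = out_arcs H x" "in_arcs G x \<inter> parcs H = in_arcs H x"
    using assms by auto
  then show "(\<Sum>e\<in>out_arcs G x. if e \<in> parcs H then 1 else 0) = real (out_degree H x)"
    "(\<Sum>e\<in>in_arcs G x. if e \<in> parcs H then 1 else 0) = real (in_degree H x)"
    by (simp_all add: sum.inter_restrict[symmetric] finite_out_arcs finite_in_arcs
        out_degree_def in_degree_def)
qed

text \<open>A natural number capped at 1 indicates whether it is positive. The capped in-degree is
  also the most that \<open>v\<close> can send to \<open>T1\<close> at capacity 1, so diversity
  compares with flow node by node.\<close>

lemma real_aggregate_diversity:
  "real (aggregate_diversity R H) = (\<Sum>v\<in>R. min 1 (real (in_degree H v)))"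
proof -
  have "real (aggregate_diversity R H) = (\<Sum>v\<in>R. if in_degree H v \<ge> 1 then 1 else 0)"
    by (simp add: aggregate_diversity_def sum.If_cases Int_def)
  also have "\<dots> = (\<Sum>v\<in>R. min 1 (real (in_degree H v)))"
    by (rule sum.cong) auto
  finally show ?thesis .
qed

section \<open>A flow for each recommendation subgraph\<close>

lemma recommendation_subgraph_flow:
  assumes H: "recommendation_subgraph G L c H"
  obtains g where "feasible_flow (min_discrepancy_network G L R c (\<lambda>_. 1)) g"
    and "flow_cost (min_discrepancy_network G L R c (\<lambda>_. 1)) g =
      2 * (real (\<Sum>u\<in>L. c u) - real (aggregate_diversity R H))"
proof -
  \<comment> \<open>One unit runs on each arc of \<open>H\<close>; every right node sends as much as
    it can through \<open>T1\<close> and the surplus directly to \<open>T2\<close>. Among the arcs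
    of the network, only \<open>(T1, T2)\<close> falls into the default case.\<close>
  define t where "t v = min 1 (real (in_degree H v))" for v
  define g where "g e = (case e of
      (Copy u, Copy v) \<Rightarrow> if (u, v) \<in> parcs H then 1 else 0
    | (Copy v, T1) \<Rightarrow> t v
    | (Copy v, T2) \<Rightarrow> real (in_degree H v) - t v
    | _ \<Rightarrow> \<Sum>v\<in>R. t v)" for e
  have g_simps: "g (Copy v, T1) = t v" "g (Copy v, T2) = real (in_degree H v) - t v"
    "g (T1, T2) = (\<Sum>v\<in>R. t v)" for v
    by (simp_all add: g_def)
  have g_copy: "g (copy_arc e) = (if e \<in> parcs H then 1 else 0)" for e
    by (cases e) (simp add: g_def)
  from H have sub: "parcs H \<subseteq> parcs G" and deg: "\<And>u. u \<in> L \<Longrightarrow> out_degree H u = c u"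
    by (auto simp: recommendation_subgraph_def subgraph_def)
  have copy_sums: "(\<Sum>e\<in>out_arcs G u. g (copy_arc e)) = real (out_degree H u)"
    "(\<Sum>e\<in>in_arcs G u. g (copy_arc e)) = real (in_degree H u)" for u
    by (simp_all add: g_copy sum_parcs_indicator[OF sub])
  have total: "(\<Sum>v\<in>R. real (in_degree H v)) = (\<Sum>u\<in>L. real (c u))"
    using sum_in_degree[OF H] by (metis of_nat_sum)
  \<comment> \<open>Balance at \<open>T2\<close> is \<open>total\<close>; the bounds hold because
    \<open>t v\<close> lies between 0 and both 1 and the in-degree of \<open>v\<close>.\<close>
  have "feasible_flow (min_discrepancy_network G L R c (\<lambda>_. 1)) g"
    unfolding feasible_flow_network_iff copy_sums
    by (auto simp: g_simps deg total sum_subtractf g_copy)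
       (auto simp: t_def intro!: sum_nonneg)
  moreover have "flow_cost (min_discrepancy_network G L R c (\<lambda>_. 1)) g =
      2 * (real (\<Sum>u\<in>L. c u) - real (aggregate_diversity R H))"
    by (simp add: flow_cost_network g_simps sum_subtractf total real_aggregate_diversity t_def)
  ultimately show thesis
    by (rule that)
qed

section \<open>The subgraph of an integral flow\<close>

context
  fixes c a :: "'a \<Rightarrow> nat" and f
  assumes feasible: "feasible_flow (min_discrepancy_network G L R c a) f"
    and integral: "integral_flow (min_discrepancy_network G L R c a) f"
begin

text \<open>An integer between 0 and 1 is 0 or 1, so an arc with positive flow carries exactly one
  unit.\<close>

lemma integral_flow_copy_arc:
  assumes "e \<in> parcs G"
  shows "f (copy_arc e) = (if e \<in> parcs (flow_subgraph G f) then 1 else 0)"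
proof -
  have "f (copy_arc e) \<in> \<int>"
    using integral assms unfolding integral_flow_def parcs_network by blast
  moreover have "0 \<le> f (copy_arc e)" "f (copy_arc e) \<le> 1"
    using feasible assms unfolding feasible_flow_network_iff by auto
  ultimately have "f (copy_arc e) = 0 \<or> f (copy_arc e) = 1"
    by (auto elim!: Ints_cases)
  then show ?thesis
    using assms by (cases e) (auto simp: flow_subgraph_def)
qed

lemma sum_integral_flow:
  "(\<Sum>e\<in>out_arcs G x. f (copy_arc e)) = real (out_degree (flow_subgraph G f) x)"
  "(\<Sum>e\<in>in_arcs G x. f (copy_arc e)) = real (in_degree (flow_subgraph G f) x)"
proof -
  have "parcs (flow_subgraph G f) \<subseteq> parcs G"
    by (auto simp: flow_subgraph_def)
  note sums = sum_parcs_indicator[OF this, of x]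
  show "(\<Sum>e\<in>out_arcs G x. f (copy_arc e)) = real (out_degree (flow_subgraph G f) x)"
    unfolding sums(1)[symmetric]
    by (rule sum.cong) (auto simp: integral_flow_copy_arc simp del: map_prod_simp)
  show "(\<Sum>e\<in>in_arcs G x. f (copy_arc e)) = real (in_degree (flow_subgraph G f) x)"
    unfolding sums(2)[symmetric]
    by (rule sum.cong) (auto simp: integral_flow_copy_arc simp del: map_prod_simp)
qed

text \<open>The supply of a left node leaves along copied arcs, one unit on each arc used, so the
  out-degree is \<open>c u\<close>.\<close>

lemma recommendation_subgraph_flow_subgraph:
  "recommendation_subgraph G L c (flow_subgraph G f)"
proof -
  have "subgraph (flow_subgraph G f) G"
    unfolding subgraph_def
    by (auto simp: flow_subgraph_def compatible_def wf_digraph_def dest: in_arcsD1 in_arcsD2)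
  moreover have "out_degree (flow_subgraph G f) u = c u" if "u \<in> L" for u
    using feasible that unfolding feasible_flow_network_iff sum_integral_flow by auto
  ultimately show ?thesis
    by (simp add: recommendation_subgraph_def)
qed

text \<open>With targets at most 1, a right node sends at most its capped in-degree to
  \<open>T1\<close>. In total at most the diversity travels for free, and the rest of the supply
  costs 2 per unit.\<close>

lemma flow_cost_lower_bound:
  assumes "\<forall>v\<in>R. a v \<le> 1"
  shows "2 * (real (\<Sum>u\<in>L. c u) - real (aggregate_diversity R (flow_subgraph G f)))
    \<le> flow_cost (min_discrepancy_network G L R c a) f"
proof -
  have "(\<Sum>v\<in>R. f (Copy v, T1)) \<le> real (aggregate_diversity R (flow_subgraph G f))"
    unfolding real_aggregate_diversity
  proof (rule sum_mono)
    fix v assume v: "v \<in> R"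
    then have "f (Copy v, T1) \<le> real (a v)" "0 \<le> f (Copy v, T2)"
      "f (Copy v, T1) + f (Copy v, T2) = real (in_degree (flow_subgraph G f) v)"
      using feasible unfolding feasible_flow_network_iff sum_integral_flow by auto
    moreover have "real (a v) \<le> 1"
      using assms v by simp
    ultimately show "f (Copy v, T1) \<le> min 1 (real (in_degree (flow_subgraph G f) v))"
      by linarith
  qed
  \<comment> \<open>Conservation at \<open>T1\<close> and \<open>T2\<close> combined, with the flow
    on \<open>(T1, T2)\<close> eliminated.\<close>
  moreover have "(\<Sum>v\<in>R. f (Copy v, T1)) + (\<Sum>v\<in>R. f (Copy v, T2)) = real (\<Sum>u\<in>L. c u)"
    using feasible unfolding feasible_flow_network_iff by simp
  ultimately show ?thesis
    by (simp add: flow_cost_network)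
qed

end

end

theorem theorem2:
  fixes G :: "'a pair_pre_digraph" and L R :: "'a set" and c :: "'a \<Rightarrow> nat"
    and f :: "'a net_node \<times> 'a net_node \<Rightarrow> real"
  assumes "directed_bipartite_graph G L R"
    and "\<forall>u\<in>L. c u \<le> out_degree G u"
    and "card R \<le> (\<Sum>u\<in>L. c u)"
    and "min_cost_flow (min_discrepancy_network G L R c (\<lambda>_. 1)) f"
    and "integral_flow (min_discrepancy_network G L R c (\<lambda>_. 1)) f"
  shows "recommendation_subgraph G L c (flow_subgraph G f) \<and>
    (\<forall>H'. recommendation_subgraph G L c H' \<longrightarrow>
       aggregate_diversity R H' \<le> aggregate_diversity R (flow_subgraph G f))"
proof (intro conjI allI impI)
  interpret directed_bipartite_graph G L R by fact
  let ?N = "min_discrepancy_network G L R c (\<lambda>_. 1)"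
  from assms(4) have feasible: "feasible_flow ?N f"
    and minimal: "\<And>g. feasible_flow ?N g \<Longrightarrow> flow_cost ?N f \<le> flow_cost ?N g"
    by (auto simp: min_cost_flow_def)
  show "recommendation_subgraph G L c (flow_subgraph G f)"
    using feasible assms(5) by (rule recommendation_subgraph_flow_subgraph)
  fix H' assume "recommendation_subgraph G L c H'"
  then obtain g where "feasible_flow ?N g"
    and "flow_cost ?N g = 2 * (real (\<Sum>u\<in>L. c u) - real (aggregate_diversity R H'))"
    by (rule recommendation_subgraph_flow)
  \<comment> \<open>The lower bound for \<open>f\<close>, its minimality against \<open>g\<close>
    and the exact cost of \<open>g\<close> form a chain, from which the common total supply
    cancels.\<close>
  with minimal flow_cost_lower_bound[OF feasible assms(5)]
  have "2 * (real (\<Sum>u\<in>L. c u) - real (aggregate_diversity R (flow_subgraph G f)))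
      \<le> 2 * (real (\<Sum>u\<in>L. c u) - real (aggregate_diversity R H'))"
    by fastforce
  then show "aggregate_diversity R H' \<le> aggregate_diversity R (flow_subgraph G f)"
    by simp
qed

end
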